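(* Let $L$ be a finite-dimensional Lie algebra over a field $F$. For every maximal subalgebra $M$ of $L$ there is a unique c-section of $M$ in $L$ up to isomorphism; that is, c-sections of $M$ in $L$ exist, and any two of them are isomorphic as Lie algebras.
   Context: A chief factor of $L$ is a quotient $C/D$ where $D \subsetneq C$ are ideals of $L$ and $C/D$ is a minimal ideal of $L/D$. Let $M$ be a maximal subalgebra of $L$ and let $C/D$ be a chief factor of $L$ with $D \subseteq M$ and $L = M + C$. Then the Lie algebra $(M \cap C)/D$ is called a c-section of $M$ in $L$. *)

theory Defs
  imports "Jordan_Normal_Form.Missing_VectorSpace" "HOL-Algebra.QuotRing"
begin

text \<open>
  Lie algebras are carrier-based, on top of the vector spaces of \<open>HOL-Algebra\<close>/\<open>VectorSpace\<close>,
  so that subalgebras, quotients and quotients of subalgebras are again such structures.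
  The fields \<open>mult\<close> and \<open>one\<close>, which \<open>module\<close> inherits from \<open>ring\<close>, play no role.
\<close>

record ('a, 'b) lie_struct = "('a, 'b) module" +
  bracket :: "'b \<Rightarrow> 'b \<Rightarrow> 'b"

locale lie_algebra = vectorspace K L
  for K :: "('k, 'r) ring_scheme" and L :: "('k, 'a, 'm) lie_struct_scheme" (structure) +
  assumes bracket_closed [intro, simp]:
      "\<lbrakk>x \<in> carrier L; y \<in> carrier L\<rbrakk> \<Longrightarrow> bracket L x y \<in> carrier L"
    and bracket_add_left:
      "\<lbrakk>x \<in> carrier L; y \<in> carrier L; z \<in> carrier L\<rbrakk>
        \<Longrightarrow> bracket L (x \<oplus> y) z = bracket L x z \<oplus> bracket L y z"
    and bracket_add_right:
      "\<lbrakk>x \<in> carrier L; y \<in> carrier L; z \<in> carrier L\<rbrakk>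
        \<Longrightarrow> bracket L x (y \<oplus> z) = bracket L x y \<oplus> bracket L x z"
    and bracket_smult_left:
      "\<lbrakk>a \<in> carrier K; x \<in> carrier L; y \<in> carrier L\<rbrakk>
        \<Longrightarrow> bracket L (a \<odot> x) y = a \<odot> bracket L x y"
    and bracket_smult_right:
      "\<lbrakk>a \<in> carrier K; x \<in> carrier L; y \<in> carrier L\<rbrakk>
        \<Longrightarrow> bracket L x (a \<odot> y) = a \<odot> bracket L x y"
    and bracket_self: "x \<in> carrier L \<Longrightarrow> bracket L x x = \<zero>"
    and jacobi:
      "\<lbrakk>x \<in> carrier L; y \<in> carrier L; z \<in> carrier L\<rbrakk>
        \<Longrightarrow> bracket L x (bracket L y z) \<oplus> bracket L y (bracket L z x)
            \<oplus> bracket L z (bracket L x y) = \<zero>"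

definition lie_subalgebra ::
  "('k, 'r) ring_scheme \<Rightarrow> ('k, 'a, 'm) lie_struct_scheme \<Rightarrow> 'a set \<Rightarrow> bool"
  where "lie_subalgebra K L H \<longleftrightarrow>
    VectorSpace.subspace K H L \<and> (\<forall>x\<in>H. \<forall>y\<in>H. bracket L x y \<in> H)"

definition lie_ideal ::
  "('k, 'r) ring_scheme \<Rightarrow> ('k, 'a, 'm) lie_struct_scheme \<Rightarrow> 'a set \<Rightarrow> bool"
  where "lie_ideal K L I \<longleftrightarrow>
    VectorSpace.subspace K I L \<and> (\<forall>x\<in>carrier L. \<forall>y\<in>I. bracket L x y \<in> I)"

definition maximal_subalgebra ::
  "('k, 'r) ring_scheme \<Rightarrow> ('k, 'a, 'm) lie_struct_scheme \<Rightarrow> 'a set \<Rightarrow> bool"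
  where "maximal_subalgebra K L M \<longleftrightarrow>
    lie_subalgebra K L M \<and> M \<noteq> carrier L \<and>
    (\<forall>H. lie_subalgebra K L H \<and> M \<subseteq> H \<longrightarrow> H = M \<or> H = carrier L)"

definition minimal_ideal ::
  "('k, 'r) ring_scheme \<Rightarrow> ('k, 'a, 'm) lie_struct_scheme \<Rightarrow> 'a set \<Rightarrow> bool"
  where "minimal_ideal K L I \<longleftrightarrow>
    lie_ideal K L I \<and> I \<noteq> {\<zero>\<^bsub>L\<^esub>} \<and>
    (\<forall>J. lie_ideal K L J \<and> J \<subseteq> I \<longrightarrow> J = {\<zero>\<^bsub>L\<^esub>} \<or> J = I)"

text \<open>
  The quotient by \<open>D\<close> lives on the cosets of \<open>D\<close>; each operation is the union, over all
  representatives, of the cosets of the results, as in \<^const>\<open>rcoset_mult\<close>.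
\<close>

definition lie_quotient ::
  "('k, 'a, 'm) lie_struct_scheme \<Rightarrow> 'a set \<Rightarrow> ('k, 'a set) lie_struct"
  where "lie_quotient L D =
    \<lparr>carrier = a_rcosets\<^bsub>L\<^esub> D,
     mult = (\<lambda>X Y. D), one = D,
     zero = D, add = (\<lambda>X Y. X <+>\<^bsub>L\<^esub> Y),
     smult = (\<lambda>a X. \<Union>x\<in>X. D +>\<^bsub>L\<^esub> (a \<odot>\<^bsub>L\<^esub> x)),
     bracket = (\<lambda>X Y. \<Union>x\<in>X. \<Union>y\<in>Y. D +>\<^bsub>L\<^esub> bracket L x y)\<rparr>"

lemma (in lie_algebra) ideal_abelian_subgroup:
  assumes "lie_ideal K L D" shows "abelian_subgroup D L"
proof -
  have s: "submodule K D L" using assms by (auto simp: lie_ideal_def subspace_def)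
  interpret D: submodule K D L by fact
  have "subgroup D (add_monoid L)"
  proof (rule add.subgroupI)
    show "D \<subseteq> carrier L" by (rule D.subset)
    show "D \<noteq> {}" using D.zero_closed by blast
  next
    fix a assume a: "a \<in> D"
    have "\<ominus>\<^bsub>L\<^esub> a = (\<ominus>\<^bsub>K\<^esub> \<one>\<^bsub>K\<^esub>) \<odot>\<^bsub>L\<^esub> a"
      using smult_l_minus[OF R.one_closed subsetD[OF D.subset a]] subsetD[OF D.subset a] by simp
    thus "\<ominus>\<^bsub>L\<^esub> a \<in> D"
      using D.smult_closed[OF R.a_inv_closed[OF R.one_closed] a] by simp
  next
    show "\<And>a b. a \<in> D \<Longrightarrow> b \<in> D \<Longrightarrow> a \<oplus> b \<in> D" by (rule D.m_closed)
  qed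
  thus ?thesis by (rule abelian_subgroupI3[OF additive_subgroup.intro M.abelian_group_axioms])
qed

context
  fixes K :: "('k, 'r) ring_scheme" and L :: "('k, 'a, 'm) lie_struct_scheme" (structure) and D
  assumes LL: "lie_algebra K L" and DD: "lie_ideal K L D"
begin

interpretation lie_algebra K L by (rule LL)
interpretation D: abelian_subgroup D L by (rule ideal_abelian_subgroup[OF DD])

lemma bracket_antisym: "x \<in> carrier L \<Longrightarrow> y \<in> carrier L \<Longrightarrow> bracket L x y = \<ominus> bracket L y x"
proof -
  assume x: "x \<in> carrier L" "y \<in> carrier L"
  have "bracket L (x \<oplus> y) (x \<oplus> y) = bracket L x y \<oplus> bracket L y x"
    using x by (simp add: bracket_add_left bracket_add_right bracket_self[of x] bracket_self[of y] M.a_comm)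
  moreover have "bracket L (x \<oplus> y) (x \<oplus> y) = \<zero>" using x by (intro bracket_self) auto
  ultimately have "bracket L x y \<oplus> bracket L y x = \<zero>" by simp
  thus ?thesis using x by (simp add: minus_equality)
qed

lemma ideal_bracket: assumes "x \<in> carrier L" "d \<in> D" shows "bracket L x d \<in> D" "bracket L d x \<in> D"
proof -
  show *: "bracket L x d \<in> D" using assms DD by (simp add: lie_ideal_def)
  have "bracket L d x = \<ominus> bracket L x d" by (rule bracket_antisym) (use assms D.a_Hcarr in auto)
  thus "bracket L d x \<in> D" using D.a_inv_closed[OF *] by simp
qed

lemma ideal_smult: "a \<in> carrier K \<Longrightarrow> d \<in> D \<Longrightarrow> a \<odot> d \<in> D"
  using DD by (auto simp: lie_ideal_def subspace_def submodule_def)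

lemma ideal_coset_eq: "d \<in> D \<Longrightarrow> x \<in> carrier L \<Longrightarrow> D +> (d \<oplus> x) = D +> x"
  using M.a_coset_add_assoc[OF D.a_subset D.a_Hcarr, of d x] by (simp add: D.a_rcos_const)

lemma ideal_cosetE: "x \<in> D +> y \<Longrightarrow> \<exists>d\<in>D. x = d \<oplus> y" by (auto simp: a_r_coset_def')

lemma ideal_coset_self: "y \<in> carrier L \<Longrightarrow> y \<in> D +> y" by (rule D.a_rcos_self)

lemma lie_quotient_smult: assumes "a \<in> carrier K" "x \<in> carrier L"
  shows "smult (lie_quotient L D) a (D +> x) = D +> (a \<odot> x)"
proof -
  have "D +> (a \<odot> z) = D +> (a \<odot> x)" if z: "z \<in> D +> x" for z
  proof -
    obtain d where "d \<in> D" "z = d \<oplus> x" using ideal_cosetE[OF z] by auto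
    thus ?thesis using assms ideal_coset_eq ideal_smult D.a_Hcarr by (simp add: smult_r_distr)
  qed
  hence "smult (lie_quotient L D) a (D +> x) = (\<Union>z\<in>D +> x. D +> (a \<odot> x))"
    by (simp add: lie_quotient_def)
  also have "\<dots> = D +> (a \<odot> x)"
    using ideal_coset_self[OF assms(2)] by blast
  finally show ?thesis .
qed

lemma lie_quotient_bracket: assumes "x \<in> carrier L" "y \<in> carrier L"
  shows "bracket (lie_quotient L D) (D +> x) (D +> y) = D +> bracket L x y"
proof -
  have "D +> bracket L z w = D +> bracket L x y" if z: "z \<in> D +> x" and w: "w \<in> D +> y" for z w
  proof -
    obtain d where d: "d \<in> D" "z = d \<oplus> x" using ideal_cosetE[OF z] by auto
    obtain e where e: "e \<in> D" "w = e \<oplus> y" using ideal_cosetE[OF w] by auto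
    have c: "d \<in> carrier L" "e \<in> carrier L" using d e D.a_Hcarr by auto
    have "D +> bracket L z w = D +> (bracket L z e \<oplus> (bracket L d y \<oplus> bracket L x y))"
      using c assms d e by (simp add: bracket_add_left bracket_add_right)
    also have "\<dots> = D +> bracket L x y"
      using c assms d e by (subst ideal_coset_eq; simp add: ideal_bracket ideal_coset_eq)
    finally show ?thesis .
  qed
  hence "bracket (lie_quotient L D) (D +> x) (D +> y)
      = (\<Union>z\<in>D +> x. \<Union>w\<in>D +> y. D +> bracket L x y)"
    by (simp add: lie_quotient_def)
  also have "\<dots> = D +> bracket L x y"
    using ideal_coset_self[OF assms(1)] ideal_coset_self[OF assms(2)] by blast
  finally show ?thesis .
qed

lemma lie_quotient_add: assumes "x \<in> carrier L" "y \<in> carrier L"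
  shows "add (lie_quotient L D) (D +> x) (D +> y) = D +> (x \<oplus> y)"
  using assms D.a_rcos_sum by (simp add: lie_quotient_def)

lemma lie_quotient_zero: "zero (lie_quotient L D) = D +> \<zero>"
  by (simp add: lie_quotient_def D.a_rcos_const)

lemma lie_quotient_carrier: "carrier (lie_quotient L D) = (\<lambda>x. D +> x) ` carrier L"
  by (auto simp: lie_quotient_def A_RCOSETS_def')

lemma lie_quotient_lie_algebra: "lie_algebra K (lie_quotient L D)"
proof -
  let ?Q = "lie_quotient L D"
  have ag: "abelian_group ?Q"
  proof (rule abelian_groupI, goal_cases)
    case (6 x)
    then obtain u where u: "u \<in> carrier L" "x = D +> u" by (auto simp: lie_quotient_carrier)
    show ?case using u by (intro bexI[of _ "D +> (\<ominus> u)"]) (auto simp: lie_quotient_carrier lie_quotient_add lie_quotient_zero M.l_neg)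
    next
    case (4 x y)
    then obtain u v where "u \<in> carrier L" "x = D +> u" "v \<in> carrier L" "y = D +> v" by (auto simp: lie_quotient_carrier)
    thus ?case by (simp add: lie_quotient_add M.a_comm)
  qed (auto simp: lie_quotient_carrier lie_quotient_add lie_quotient_zero M.a_assoc)
  have m: "module K ?Q"
    by (rule moduleI[OF is_cring ag]) (auto simp: lie_quotient_carrier lie_quotient_add lie_quotient_smult smult_l_distr smult_r_distr smult_assoc1)
  note Q = lie_quotient_add lie_quotient_zero lie_quotient_smult lie_quotient_bracket
  show ?thesis
  proof (intro lie_algebra.intro vectorspace.intro m field_axioms lie_algebra_axioms.intro)
    fix x y assume "x \<in> carrier ?Q" "y \<in> carrier ?Q"
    thus "bracket ?Q x y \<in> carrier ?Q" by (auto simp: lie_quotient_carrier Q)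
  next
    fix x y z assume "x \<in> carrier ?Q" "y \<in> carrier ?Q" "z \<in> carrier ?Q"
    then obtain u v w where "u \<in> carrier L" "v \<in> carrier L" "w \<in> carrier L"
      "x = D +> u" "y = D +> v" "z = D +> w" by (auto simp: lie_quotient_carrier)
    note * = this
    show "bracket ?Q (x \<oplus>\<^bsub>?Q\<^esub> y) z = bracket ?Q x z \<oplus>\<^bsub>?Q\<^esub> bracket ?Q y z"
      using * by (simp add: Q bracket_add_left)
    show "bracket ?Q x (y \<oplus>\<^bsub>?Q\<^esub> z) = bracket ?Q x y \<oplus>\<^bsub>?Q\<^esub> bracket ?Q x z"
      using * by (simp add: Q bracket_add_right)
    show "bracket ?Q x (bracket ?Q y z) \<oplus>\<^bsub>?Q\<^esub> bracket ?Q y (bracket ?Q z x)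
        \<oplus>\<^bsub>?Q\<^esub> bracket ?Q z (bracket ?Q x y) = \<zero>\<^bsub>?Q\<^esub>"
      using * by (simp add: Q jacobi)
  next
    fix a x y assume "a \<in> carrier K" "x \<in> carrier ?Q" "y \<in> carrier ?Q"
    then obtain u v where "u \<in> carrier L" "v \<in> carrier L" "a \<in> carrier K"
      "x = D +> u" "y = D +> v" by (auto simp: lie_quotient_carrier)
    note * = this
    show "bracket ?Q (a \<odot>\<^bsub>?Q\<^esub> x) y = a \<odot>\<^bsub>?Q\<^esub> bracket ?Q x y"
      using * by (simp add: Q bracket_smult_left)
    show "bracket ?Q x (a \<odot>\<^bsub>?Q\<^esub> y) = a \<odot>\<^bsub>?Q\<^esub> bracket ?Q x y"
      using * by (simp add: Q bracket_smult_right)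
  next
    fix x assume "x \<in> carrier ?Q"
    thus "bracket ?Q x x = \<zero>\<^bsub>?Q\<^esub>" by (auto simp: lie_quotient_carrier Q bracket_self)
  qed
qed
end

text \<open>
  For \<open>D \<subseteq> H \<subseteq> L\<close> the quotient \<open>H/D\<close> is \<open>lie_quotient (L\<lparr>carrier := H\<rparr>) D\<close>;
  its carrier is a subset of the carrier of \<open>L/D\<close>.
\<close>

definition chief_factor ::
  "('k, 'r) ring_scheme \<Rightarrow> ('k, 'a, 'm) lie_struct_scheme \<Rightarrow> 'a set \<Rightarrow> 'a set \<Rightarrow> bool"
  where "chief_factor K L C D \<longleftrightarrow>
    lie_ideal K L C \<and> lie_ideal K L D \<and> D \<subset> C \<and>
    minimal_ideal K (lie_quotient L D) (carrier (lie_quotient (L\<lparr>carrier := C\<rparr>) D))"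

definition c_section ::
  "('k, 'r) ring_scheme \<Rightarrow> ('k, 'a, 'm) lie_struct_scheme \<Rightarrow> 'a set
    \<Rightarrow> ('k, 'a set) lie_struct \<Rightarrow> bool"
  where "c_section K L M S \<longleftrightarrow>
    (\<exists>C D. chief_factor K L C D \<and> D \<subseteq> M \<and> carrier L = M <+>\<^bsub>L\<^esub> C \<and>
      S = lie_quotient (L\<lparr>carrier := M \<inter> C\<rparr>) D)"

definition lie_isomorphic ::
  "('k, 'r) ring_scheme \<Rightarrow> ('k, 'a, 'm) lie_struct_scheme
    \<Rightarrow> ('k, 'b, 'n) lie_struct_scheme \<Rightarrow> bool"
  where "lie_isomorphic K A B \<longleftrightarrow>
    lie_algebra K A \<and> lie_algebra K B \<and>
    (\<exists>f \<in> module_hom K A B. bij_betw f (carrier A) (carrier B) \<and>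
      (\<forall>x\<in>carrier A. \<forall>y\<in>carrier A. f (bracket A x y) = bracket B (f x) (f y)))"

end

theory Submission
  imports Defs
begin

text \<open>
  Existence: take an ideal \<open>C\<close> minimal among those not contained in \<open>M\<close>, and an ideal \<open>D\<close>
  maximal among those contained in \<open>M \<inter> C\<close>.

  Uniqueness: let \<open>C/D\<close> and \<open>E/F\<close> both define c-sections. If \<open>C \<inter> E \<subseteq> M\<close>, then
  \<open>[E, M \<inter> C] \<subseteq> M\<close>, so \<open>M \<inter> C\<close> is an ideal of \<open>L = M + E\<close>, hence equal to \<open>D\<close>;
  symmetrically \<open>M \<inter> E = F\<close>, and both c-sections vanish. Otherwise \<open>G = C \<inter> E\<close> satisfies
  \<open>C = G + D\<close> and \<open>E = G + F\<close>, so \<open>M \<inter> C = (M \<inter> G) + D\<close> and \<open>M \<inter> E = (M \<inter> G) + F\<close>,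
  while \<open>G \<inter> D = G \<inter> F\<close>; both c-sections are then \<open>(M \<inter> G) / (G \<inter> D)\<close>.
\<close>

section \<open>Rank of subsets of a finite-dimensional space\<close>

text \<open>In finite dimension this is the dimension when \<open>W\<close> is a subspace. It is
  expressed inside the ambient space, so that ideals can be compared in size without becoming vector
  spaces of their own.\<close>

definition (in vectorspace) rank :: "'c set \<Rightarrow> nat"
  where "rank W = Max (card ` {A. A \<subseteq> W \<and> lin_indpt A})"

lemma (in vectorspace) card_lin_indpt_bounded:
  assumes "fin_dim" "W \<subseteq> carrier V"
  shows "card ` {A. A \<subseteq> W \<and> lin_indpt A} \<subseteq> {..dim}"
  using li_le_dim[OF assms(1)] assms(2) by blast

lemma (in vectorspace) rank_attained:
  assumes "fin_dim" "W \<subseteq> carrier V"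
  obtains A where "A \<subseteq> W" "lin_indpt A" "card A = rank W"
proof -
  \<comment> \<open>The empty set keeps the family under \<open>Max\<close> nonempty; the bound by
    \<open>dim\<close> keeps it finite.\<close>
  have "lin_indpt {}" by (auto simp: lin_dep_def)
  then have "rank W \<in> card ` {A. A \<subseteq> W \<and> lin_indpt A}"
    unfolding rank_def
    by (intro Max_in finite_subset[OF card_lin_indpt_bounded[OF assms]]) auto
  then show thesis using that by auto
qed

lemma (in vectorspace) card_le_rank:
  assumes "fin_dim" "W \<subseteq> carrier V" "A \<subseteq> W" "lin_indpt A"
  shows "card A \<le> rank W"
  unfolding rank_def using assms
  by (intro Max_ge finite_subset[OF card_lin_indpt_bounded[OF assms(1,2)]]) auto

lemma (in vectorspace) rank_le_dim:
  assumes "fin_dim" "W \<subseteq> carrier V"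
  shows "rank W \<le> dim"
  using rank_attained[OF assms] li_le_dim(2)[OF assms(1)] assms(2) by (metis subset_trans)

text \<open>A largest independent subset of \<open>U\<close> stays independent when a vector of
  \<open>W\<close> outside \<open>U\<close> is adjoined, because its span lies in the submodule
  \<open>U\<close>.\<close>

lemma (in vectorspace) rank_strict_mono:
  assumes fd: "fin_dim" and U: "submodule K U V" and W: "W \<subseteq> carrier V" and UW: "U \<subset> W"
  shows "rank U < rank W"
proof -
  have Uc: "U \<subseteq> carrier V" using UW W by blast
  obtain A where A: "A \<subseteq> U" "lin_indpt A" "card A = rank U"
    by (rule rank_attained[OF fd Uc])
  obtain v where v: "v \<in> W" "v \<notin> U" using UW by blast
  have "v \<notin> span A" using span_is_subset[OF A(1) U] v by blast
  then have "lin_indpt (A \<union> {v})"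
    using lin_dep_iff_in_span[of A v] A v Uc W by blast
  then have "card (A \<union> {v}) \<le> rank W"
    using A(1) UW v by (intro card_le_rank[OF fd W]) auto
  moreover have "finite A" using li_le_dim(1)[OF fd _ A(2)] A(1) Uc by blast
  moreover have "v \<notin> A" using A(1) v by blast
  ultimately show ?thesis using A(3) by simp
qed

section \<open>Subalgebras, ideals and cosets\<close>

context lie_algebra
begin

lemma lie_subalgebra_iff:
  "lie_subalgebra K L H \<longleftrightarrow> H \<subseteq> carrier L \<and> \<zero> \<in> H \<and> (\<forall>x\<in>H. \<forall>y\<in>H. x \<oplus> y \<in> H) \<and>
    (\<forall>a\<in>carrier K. \<forall>x\<in>H. a \<odot> x \<in> H) \<and> (\<forall>x\<in>H. \<forall>y\<in>H. bracket L x y \<in> H)"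
  using vectorspace_axioms module_axioms
  by (auto simp: lie_subalgebra_def subspace_def submodule_def)

lemma lie_ideal_iff:
  "lie_ideal K L I \<longleftrightarrow> I \<subseteq> carrier L \<and> \<zero> \<in> I \<and> (\<forall>x\<in>I. \<forall>y\<in>I. x \<oplus> y \<in> I) \<and>
    (\<forall>a\<in>carrier K. \<forall>x\<in>I. a \<odot> x \<in> I) \<and> (\<forall>x\<in>carrier L. \<forall>y\<in>I. bracket L x y \<in> I)"
  using vectorspace_axioms module_axioms
  by (auto simp: lie_ideal_def subspace_def submodule_def)

lemma lie_ideal_imp_subalgebra: "lie_ideal K L I \<Longrightarrow> lie_subalgebra K L I"
  by (auto simp: lie_ideal_iff lie_subalgebra_iff)

lemma lie_subalgebra_minus:
  assumes "lie_subalgebra K L H" "x \<in> H" "y \<in> H"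
  shows "x \<ominus> y \<in> H"
proof -
  \<comment> \<open>The membership conditions list no negation; it is scalar multiplication by minus
    one.\<close>
  have "\<ominus> y = (\<ominus>\<^bsub>K\<^esub> \<one>\<^bsub>K\<^esub>) \<odot> y"
    using assms by (auto simp: lie_subalgebra_iff smult_minus_1)
  then show ?thesis
    using assms by (auto simp: lie_subalgebra_iff a_minus_def)
qed

lemmas lie_ideal_minus = lie_subalgebra_minus[OF lie_ideal_imp_subalgebra]

text \<open>Ideals are defined by absorption in the second argument of the bracket; antisymmetry
  carries it over to the first.\<close>

lemma lie_ideal_bracket_left:
  "\<lbrakk>lie_ideal K L I; x \<in> I; y \<in> carrier L\<rbrakk> \<Longrightarrow> bracket L x y \<in> I"
  using ideal_bracket(2)[OF lie_algebra_axioms] by blast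

lemma minus_add_cancel:
  "\<lbrakk>x \<in> carrier L; y \<in> carrier L\<rbrakk> \<Longrightarrow> (x \<ominus> y) \<oplus> y = x"
  by (simp add: a_minus_def M.a_assoc M.l_neg)

lemma add_minus_cancel:
  "\<lbrakk>x \<in> carrier L; y \<in> carrier L\<rbrakk> \<Longrightarrow> (x \<oplus> y) \<ominus> y = x"
  by (simp add: a_minus_def M.a_assoc M.r_neg)

lemma coset_eq_iff:
  assumes D: "lie_ideal K L D" and x: "x \<in> carrier L" and y: "y \<in> carrier L"
  shows "D +> x = D +> y \<longleftrightarrow> x \<ominus> y \<in> D"
proof
  assume "D +> x = D +> y"
  then have "x \<in> D +> y"
    using ideal_coset_self[OF lie_algebra_axioms D x] by simp
  then obtain d where d: "d \<in> D" "x = d \<oplus> y"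
    using ideal_cosetE[OF lie_algebra_axioms D] by blast
  have "d \<in> carrier L" using d(1) D by (auto simp: lie_ideal_iff)
  then show "x \<ominus> y \<in> D" using d y by (simp add: add_minus_cancel)
next
  assume "x \<ominus> y \<in> D"
  then show "D +> x = D +> y"
    using ideal_coset_eq[OF lie_algebra_axioms D _ y, of "x \<ominus> y"] x y
    by (simp add: minus_add_cancel)
qed

section \<open>Sums and intersections of subalgebras and ideals\<close>

lemma mem_set_add: "z \<in> A <+>\<^bsub>L\<^esub> B \<longleftrightarrow> (\<exists>x\<in>A. \<exists>y\<in>B. z = x \<oplus> y)"
  by (auto simp: set_add_def')

lemma set_addI: "\<lbrakk>x \<in> A; y \<in> B\<rbrakk> \<Longrightarrow> x \<oplus> y \<in> A <+>\<^bsub>L\<^esub> B"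
  by (auto simp: mem_set_add)

lemma subset_set_add_left:
  assumes "A \<subseteq> carrier L" "\<zero> \<in> B"
  shows "A \<subseteq> A <+>\<^bsub>L\<^esub> B"
proof
  fix x assume "x \<in> A"
  then have "x = x \<oplus> \<zero>" using assms by auto
  then show "x \<in> A <+>\<^bsub>L\<^esub> B" using \<open>x \<in> A\<close> assms(2) by (auto simp: mem_set_add)
qed

lemma subset_set_add_right:
  assumes "\<zero> \<in> A" "B \<subseteq> carrier L"
  shows "B \<subseteq> A <+>\<^bsub>L\<^esub> B"
proof
  fix x assume "x \<in> B"
  then have "x = \<zero> \<oplus> x" using assms by auto
  then show "x \<in> A <+>\<^bsub>L\<^esub> B" using \<open>x \<in> B\<close> assms(1) by (auto simp: mem_set_add)
qed

lemma set_add_subset: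
  "\<lbrakk>lie_subalgebra K L H; A \<subseteq> H; B \<subseteq> H\<rbrakk> \<Longrightarrow> A <+>\<^bsub>L\<^esub> B \<subseteq> H"
  by (auto simp: lie_subalgebra_iff mem_set_add subset_iff)

lemma add_interchange:
  assumes "a \<in> carrier L" "b \<in> carrier L" "c \<in> carrier L" "d \<in> carrier L"
  shows "(a \<oplus> b) \<oplus> (c \<oplus> d) = (a \<oplus> c) \<oplus> (b \<oplus> d)"
  using assms by (simp add: M.a_ac)

lemma subalgebra_add_ideal:
  assumes P: "lie_subalgebra K L P" and D: "lie_ideal K L D"
  shows "lie_subalgebra K L (P <+>\<^bsub>L\<^esub> D)"
  unfolding lie_subalgebra_iff
proof (intro conjI ballI)
  have Pc: "P \<subseteq> carrier L" and Dc: "D \<subseteq> carrier L"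
    using P D by (auto simp: lie_subalgebra_iff lie_ideal_iff)
  show "P <+>\<^bsub>L\<^esub> D \<subseteq> carrier L" using Pc Dc by (auto simp: mem_set_add subset_iff)
  show "\<zero> \<in> P <+>\<^bsub>L\<^esub> D"
    using P D subset_set_add_left[of P D] by (auto simp: lie_subalgebra_iff lie_ideal_iff)
  fix x assume "x \<in> P <+>\<^bsub>L\<^esub> D"
  then obtain p d where x: "p \<in> P" "d \<in> D" "x = p \<oplus> d" by (auto simp: mem_set_add)
  {
    fix y assume "y \<in> P <+>\<^bsub>L\<^esub> D"
    then obtain q e where y: "q \<in> P" "e \<in> D" "y = q \<oplus> e" by (auto simp: mem_set_add)
    have c: "p \<in> carrier L" "d \<in> carrier L" "q \<in> carrier L" "e \<in> carrier L"
      using x y Pc Dc by auto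
    have "x \<oplus> y = (p \<oplus> q) \<oplus> (d \<oplus> e)"
      using x y c by (simp add: add_interchange)
    then show "x \<oplus> y \<in> P <+>\<^bsub>L\<^esub> D"
      using x y P D by (simp add: set_addI lie_subalgebra_iff lie_ideal_iff)
    \<comment> \<open>Every term of the expanded bracket except \<open>bracket L p q\<close> has a
      factor in the ideal \<open>D\<close>; these terms are grouped into one summand from
      \<open>D\<close>.\<close>
    have "bracket L x y = bracket L p q \<oplus> (bracket L p e \<oplus> bracket L d (q \<oplus> e))"
      using x y c by (simp add: bracket_add_left bracket_add_right M.a_ac)
    moreover have "bracket L p e \<oplus> bracket L d (q \<oplus> e) \<in> D"
      using x y c D lie_ideal_bracket_left[OF D x(2), of "q \<oplus> e"] by (simp add: lie_ideal_iff)
    moreover have "bracket L p q \<in> P" using x y P by (simp add: lie_subalgebra_iff)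
    ultimately show "bracket L x y \<in> P <+>\<^bsub>L\<^esub> D" by (auto simp: mem_set_add)
  }
  fix a assume a: "a \<in> carrier K"
  then have "a \<odot> x = a \<odot> p \<oplus> a \<odot> d"
    using x Pc Dc by (auto simp: smult_r_distr subset_iff)
  then show "a \<odot> x \<in> P <+>\<^bsub>L\<^esub> D"
    using x a P D by (simp add: set_addI lie_subalgebra_iff lie_ideal_iff)
qed

lemma ideal_add_ideal:
  assumes C: "lie_ideal K L C" and D: "lie_ideal K L D"
  shows "lie_ideal K L (C <+>\<^bsub>L\<^esub> D)"
proof -
  have "bracket L x y \<in> C <+>\<^bsub>L\<^esub> D" if x: "x \<in> carrier L" and "y \<in> C <+>\<^bsub>L\<^esub> D" for x y
  proof -
    obtain c d where y: "c \<in> C" "d \<in> D" "y = c \<oplus> d" using \<open>y \<in> C <+>\<^bsub>L\<^esub> D\<close> by (auto simp: mem_set_add)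
    have "c \<in> carrier L" "d \<in> carrier L" using y C D by (auto simp: lie_ideal_iff)
    then have "bracket L x y = bracket L x c \<oplus> bracket L x d"
      using x y by (simp add: bracket_add_right)
    then show ?thesis using x y C D by (simp add: set_addI lie_ideal_iff)
  qed
  moreover have "lie_subalgebra K L (C <+>\<^bsub>L\<^esub> D)"
    by (intro subalgebra_add_ideal lie_ideal_imp_subalgebra C D)
  ultimately show ?thesis by (simp add: lie_ideal_iff lie_subalgebra_iff)
qed

lemma ideal_Int: "\<lbrakk>lie_ideal K L C; lie_ideal K L D\<rbrakk> \<Longrightarrow> lie_ideal K L (C \<inter> D)"
  by (auto simp: lie_ideal_iff)

lemma subalgebra_Int: "\<lbrakk>lie_subalgebra K L H; lie_subalgebra K L P\<rbrakk> \<Longrightarrow> lie_subalgebra K L (H \<inter> P)"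
  by (auto simp: lie_subalgebra_iff)

lemma carrier_ideal: "lie_ideal K L (carrier L)"
  by (auto simp: lie_ideal_iff)

lemma zero_ideal: "lie_ideal K L {\<zero>}"
proof -
  have "bracket L x \<zero> = \<zero>" if "x \<in> carrier L" for x
  proof -
    have "bracket L x \<zero> = bracket L x (\<zero>\<^bsub>K\<^esub> \<odot> \<zero>)" by simp
    also have "\<dots> = \<zero>\<^bsub>K\<^esub> \<odot> bracket L x \<zero>"
      using that by (intro bracket_smult_right) auto
    finally show ?thesis using that by simp
  qed
  then show ?thesis by (auto simp: lie_ideal_iff)
qed

section \<open>Quotients of subalgebras and the second isomorphism theorem\<close>

lemma lie_algebra_restrict:
  assumes H: "lie_subalgebra K L H"
  shows "lie_algebra K (L\<lparr>carrier := H\<rparr>)"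
proof -
  have "vectorspace K (L\<lparr>carrier := H\<rparr>)"
    using H by (intro subspace_is_vs) (simp add: lie_subalgebra_def)
  moreover have "H \<subseteq> carrier L" using H by (simp add: lie_subalgebra_iff)
  ultimately show ?thesis
    using H
    by (intro lie_algebra.intro lie_algebra_axioms.intro)
      (auto simp: lie_subalgebra_iff subset_iff bracket_add_left bracket_add_right
        bracket_smult_left bracket_smult_right bracket_self jacobi)
qed

lemma lie_ideal_restrict:
  assumes H: "lie_subalgebra K L H" and D: "lie_ideal K L D" "D \<subseteq> H"
  shows "lie_ideal K (L\<lparr>carrier := H\<rparr>) D"
proof -
  interpret H: lie_algebra K "L\<lparr>carrier := H\<rparr>" by (rule lie_algebra_restrict[OF H])
  show ?thesis using H D by (auto simp: H.lie_ideal_iff lie_ideal_iff lie_subalgebra_iff)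
qed

lemma coset_restrict: "D +>\<^bsub>L\<lparr>carrier := H\<rparr>\<^esub> x = D +> x"
  by (simp add: a_r_coset_def')

text \<open>Cosets depend only on the addition, which restriction of the carrier leaves alone. Hence
  the elements of \<open>H/D\<close> are literally cosets \<open>D +> x\<close> of \<open>L\<close>,
  and its operations can be computed on representatives in \<open>H\<close>.\<close>

lemma restricted_quotient:
  assumes H: "lie_subalgebra K L H" and D: "lie_ideal K L D" "D \<subseteq> H"
  shows restricted_quotient_carrier:
      "carrier (lie_quotient (L\<lparr>carrier := H\<rparr>) D) = (\<lambda>x. D +> x) ` H"
    and restricted_quotient_add: "\<lbrakk>x \<in> H; y \<in> H\<rbrakk> \<Longrightarrow>
      add (lie_quotient (L\<lparr>carrier := H\<rparr>) D) (D +> x) (D +> y) = D +> (x \<oplus> y)"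
    and restricted_quotient_smult: "\<lbrakk>a \<in> carrier K; x \<in> H\<rbrakk> \<Longrightarrow>
      smult (lie_quotient (L\<lparr>carrier := H\<rparr>) D) a (D +> x) = D +> (a \<odot> x)"
    and restricted_quotient_bracket: "\<lbrakk>x \<in> H; y \<in> H\<rbrakk> \<Longrightarrow>
      bracket (lie_quotient (L\<lparr>carrier := H\<rparr>) D) (D +> x) (D +> y) = D +> bracket L x y"
    and restricted_quotient_lie_algebra: "lie_algebra K (lie_quotient (L\<lparr>carrier := H\<rparr>) D)"
proof -
  note * = lie_algebra_restrict[OF H] lie_ideal_restrict[OF H D]
  show "carrier (lie_quotient (L\<lparr>carrier := H\<rparr>) D) = (\<lambda>x. D +> x) ` H"
    using lie_quotient_carrier[OF *] by (simp add: coset_restrict)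
  show "add (lie_quotient (L\<lparr>carrier := H\<rparr>) D) (D +> x) (D +> y) = D +> (x \<oplus> y)"
    if "x \<in> H" "y \<in> H"
    using lie_quotient_add[OF *, of x y] that by (simp add: coset_restrict)
  show "smult (lie_quotient (L\<lparr>carrier := H\<rparr>) D) a (D +> x) = D +> (a \<odot> x)"
    if "a \<in> carrier K" "x \<in> H"
    using lie_quotient_smult[OF *, of a x] that by (simp add: coset_restrict)
  show "bracket (lie_quotient (L\<lparr>carrier := H\<rparr>) D) (D +> x) (D +> y) = D +> bracket L x y"
    if "x \<in> H" "y \<in> H"
    using lie_quotient_bracket[OF *, of x y] that by (simp add: coset_restrict)
  show "lie_algebra K (lie_quotient (L\<lparr>carrier := H\<rparr>) D)"
    by (rule lie_quotient_lie_algebra[OF *])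
qed

text \<open>Both quotients are \<open>P / (P \<inter> D)\<close> by the second isomorphism theorem.\<close>

lemma lie_isomorphic_add_quotient:
  assumes P: "lie_subalgebra K L P" and D: "lie_ideal K L D" and F: "lie_ideal K L F"
    and PDF: "P \<inter> D = P \<inter> F"
  shows "lie_isomorphic K (lie_quotient (L\<lparr>carrier := P <+>\<^bsub>L\<^esub> D\<rparr>) D)
    (lie_quotient (L\<lparr>carrier := P <+>\<^bsub>L\<^esub> F\<rparr>) F)"
proof -
  have Pc: "P \<subseteq> carrier L" using P by (simp add: lie_subalgebra_iff)
  \<comment> \<open>Collected for a general ideal \<open>I\<close>, to be used for both
    \<open>D\<close> and \<open>F\<close>. The last fact says that every coset in
    \<open>(P + I)/I\<close> has a representative in \<open>P\<close>.\<close>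
  have restr: "lie_subalgebra K L (P <+>\<^bsub>L\<^esub> I)" "I \<subseteq> P <+>\<^bsub>L\<^esub> I" "P \<subseteq> P <+>\<^bsub>L\<^esub> I"
    "(\<lambda>x. I +> x) ` (P <+>\<^bsub>L\<^esub> I) = (\<lambda>x. I +> x) ` P" if I: "lie_ideal K L I" for I
  proof -
    show "lie_subalgebra K L (P <+>\<^bsub>L\<^esub> I)" by (rule subalgebra_add_ideal[OF P I])
    show "I \<subseteq> P <+>\<^bsub>L\<^esub> I" "P \<subseteq> P <+>\<^bsub>L\<^esub> I"
      using P I by (simp_all add: lie_subalgebra_iff lie_ideal_iff subset_set_add_left
          subset_set_add_right)
    have "I +> (p \<oplus> d) = I +> p" if "p \<in> P" "d \<in> I" for p d
    proof -
      have "p \<in> carrier L" "d \<in> carrier L" using that Pc I by (auto simp: lie_ideal_iff)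
      then show ?thesis
        using ideal_coset_eq[OF lie_algebra_axioms I \<open>d \<in> I\<close>, of p] by (simp add: M.a_comm)
    qed
    then show "(\<lambda>x. I +> x) ` (P <+>\<^bsub>L\<^esub> I) = (\<lambda>x. I +> x) ` P"
      using \<open>P \<subseteq> P <+>\<^bsub>L\<^esub> I\<close> by (auto simp: mem_set_add)
  qed
  define A where "A = lie_quotient (L\<lparr>carrier := P <+>\<^bsub>L\<^esub> D\<rparr>) D"
  define B where "B = lie_quotient (L\<lparr>carrier := P <+>\<^bsub>L\<^esub> F\<rparr>) F"
  note A = restricted_quotient[OF restr(1)[OF D] D restr(2)[OF D], folded A_def]
  note B = restricted_quotient[OF restr(1)[OF F] F restr(2)[OF F], folded B_def]
  have carrA: "carrier A = (\<lambda>x. D +> x) ` P" and carrB: "carrier B = (\<lambda>x. F +> x) ` P"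
    using A(1) B(1) restr(4)[OF D] restr(4)[OF F] by simp_all
  have closed: "\<And>x y. \<lbrakk>x \<in> P; y \<in> P\<rbrakk> \<Longrightarrow> x \<oplus> y \<in> P"
    "\<And>x y. \<lbrakk>x \<in> P; y \<in> P\<rbrakk> \<Longrightarrow> bracket L x y \<in> P"
    "\<And>a x. \<lbrakk>a \<in> carrier K; x \<in> P\<rbrakk> \<Longrightarrow> a \<odot> x \<in> P"
    using P by (auto simp: lie_subalgebra_iff)
  have P_D: "x \<in> P <+>\<^bsub>L\<^esub> D" and P_F: "x \<in> P <+>\<^bsub>L\<^esub> F" if "x \<in> P" for x
    using that restr(3)[OF D] restr(3)[OF F] by auto
  \<comment> \<open>For \<open>x\<close> and \<open>y\<close> in \<open>P\<close> the difference
    lies in \<open>P\<close>, where membership in \<open>D\<close> and in \<open>F\<close> coincide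
    by \<open>PDF\<close>. One direction makes the map below well defined, the other makes it
    injective.\<close>
  have coset_eq: "D +> x = D +> y \<longleftrightarrow> F +> x = F +> y" if "x \<in> P" "y \<in> P" for x y
  proof -
    have "x \<ominus> y \<in> P" by (rule lie_subalgebra_minus[OF P that])
    then show ?thesis
      using that Pc PDF coset_eq_iff[OF D, of x y] coset_eq_iff[OF F, of x y] by blast
  qed
  \<comment> \<open>The map sends \<open>D +> x\<close> to \<open>F +> x\<close> for
    \<open>x\<close> in \<open>P\<close>. The union avoids choosing a representative: all
    representatives in \<open>P\<close> contribute the same coset of \<open>F\<close>.\<close>
  define f where "f X = (\<Union>x\<in>X \<inter> P. F +> x)" for X
  have f: "f (D +> x) = F +> x" if x: "x \<in> P" for x
  proof -
    have xc: "x \<in> carrier L" using x Pc by blast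
    have "F +> y = F +> x" if y: "y \<in> D +> x" "y \<in> P" for y
    proof -
      obtain d where "d \<in> D" "y = d \<oplus> x"
        using ideal_cosetE[OF lie_algebra_axioms D y(1)] by blast
      then have "D +> x = D +> y"
        using ideal_coset_eq[OF lie_algebra_axioms D _ xc] by simp
      then show ?thesis using coset_eq[OF x y(2)] by simp
    qed
    moreover have "x \<in> D +> x" by (rule ideal_coset_self[OF lie_algebra_axioms D xc])
    ultimately show ?thesis unfolding f_def using x by blast
  qed
  have f_add: "f (X \<oplus>\<^bsub>A\<^esub> Y) = f X \<oplus>\<^bsub>B\<^esub> f Y"
    and f_bracket: "f (bracket A X Y) = bracket B (f X) (f Y)"
    if "X \<in> carrier A" "Y \<in> carrier A" for X Y
  proof -
    obtain x y where "x \<in> P" "X = D +> x" "y \<in> P" "Y = D +> y"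
      using \<open>X \<in> carrier A\<close> \<open>Y \<in> carrier A\<close> unfolding carrA by blast
    then show "f (X \<oplus>\<^bsub>A\<^esub> Y) = f X \<oplus>\<^bsub>B\<^esub> f Y" "f (bracket A X Y) = bracket B (f X) (f Y)"
      by (simp_all add: A(2,4) B(2,4) P_D P_F f closed)
  qed
  have f_smult: "f (a \<odot>\<^bsub>A\<^esub> X) = a \<odot>\<^bsub>B\<^esub> f X" if "a \<in> carrier K" "X \<in> carrier A" for a X
  proof -
    obtain x where "x \<in> P" "X = D +> x" using \<open>X \<in> carrier A\<close> unfolding carrA by blast
    then show ?thesis using \<open>a \<in> carrier K\<close> by (simp add: A(3) B(3) P_D P_F f closed)
  qed
  have bij: "bij_betw f (carrier A) (carrier B)"
  proof (rule bij_betw_imageI)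
    show "inj_on f (carrier A)"
    proof (rule inj_onI)
      fix X Y assume "X \<in> carrier A" "Y \<in> carrier A" and eq: "f X = f Y"
      then obtain x y where x: "x \<in> P" "X = D +> x" and y: "y \<in> P" "Y = D +> y"
        unfolding carrA by blast
      then have "F +> x = F +> y" using eq f by metis
      then show "X = Y" using coset_eq x y by metis
    qed
    show "f ` carrier A = carrier B"
      unfolding carrA carrB image_image by (rule image_cong[OF refl f])
  qed
  then have "f \<in> module_hom K A B"
    using f_add f_smult by (auto simp: module_hom_def dest: bij_betwE)
  then show ?thesis
    using A(5) B(5) bij f_bracket
    unfolding lie_isomorphic_def A_def[symmetric] B_def[symmetric] by blast
qed

section \<open>Ideals of a quotient and chief factors\<close>

lemma ideal_preimage:
  assumes D: "lie_ideal K L D" and J: "lie_ideal K (lie_quotient L D) J"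
  shows "lie_ideal K L {x \<in> carrier L. D +> x \<in> J}"
proof -
  interpret Q: lie_algebra K "lie_quotient L D"
    by (rule lie_quotient_lie_algebra[OF lie_algebra_axioms D])
  note * = lie_algebra_axioms D
  note J = J[unfolded Q.lie_ideal_iff]
  have "D +> (x \<oplus> y) \<in> J" if "x \<in> carrier L" "y \<in> carrier L" "D +> x \<in> J" "D +> y \<in> J" for x y
    using J that by (metis lie_quotient_add[OF *])
  moreover have "D +> (a \<odot> x) \<in> J" if "a \<in> carrier K" "x \<in> carrier L" "D +> x \<in> J" for a x
    using J that by (metis lie_quotient_smult[OF *])
  moreover have "D +> bracket L x y \<in> J"
    if "x \<in> carrier L" "y \<in> carrier L" "D +> y \<in> J" for x y
    using J that by (metis lie_quotient_bracket[OF *] lie_quotient_carrier[OF *] imageI)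
  moreover have "D +> \<zero> \<in> J"
    using J by (simp add: lie_quotient_zero[OF *])
  ultimately show ?thesis by (auto simp: lie_ideal_iff)
qed

lemma ideal_image:
  assumes D: "lie_ideal K L D" and J: "lie_ideal K L J"
  shows "lie_ideal K (lie_quotient L D) ((\<lambda>x. D +> x) ` J)"
proof -
  interpret Q: lie_algebra K "lie_quotient L D"
    by (rule lie_quotient_lie_algebra[OF lie_algebra_axioms D])
  note * = lie_algebra_axioms D
  have "J \<subseteq> carrier L" using J by (simp add: lie_ideal_iff)
  then show ?thesis
    using J unfolding Q.lie_ideal_iff
    by (auto simp: lie_ideal_iff subset_iff lie_quotient_carrier[OF *] lie_quotient_zero[OF *]
        lie_quotient_add[OF *] lie_quotient_smult[OF *] lie_quotient_bracket[OF *])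
qed

text \<open>An ideal containing \<open>D\<close> is a union of cosets of \<open>D\<close>, so it can
  be recovered from its image in the quotient.\<close>

lemma coset_mem_image_iff:
  assumes D: "lie_ideal K L D" and J: "lie_ideal K L J" and "D \<subseteq> J" and x: "x \<in> carrier L"
  shows "D +> x \<in> (\<lambda>x. D +> x) ` J \<longleftrightarrow> x \<in> J"
proof
  assume "D +> x \<in> (\<lambda>x. D +> x) ` J"
  then obtain y where y: "y \<in> J" "D +> x = D +> y" by blast
  then have yc: "y \<in> carrier L" using J by (auto simp: lie_ideal_iff)
  then have "x \<ominus> y \<in> J" using y coset_eq_iff[OF D x] \<open>D \<subseteq> J\<close> by blast
  then have "(x \<ominus> y) \<oplus> y \<in> J" using y(1) J by (simp add: lie_ideal_iff)
  then show "x \<in> J" using x yc by (simp add: minus_add_cancel)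
qed simp

text \<open>By the correspondence between ideals of \<open>L/D\<close> and ideals of
  \<open>L\<close> containing \<open>D\<close>, minimality of \<open>C/D\<close> means that no ideal
  lies strictly between \<open>D\<close> and \<open>C\<close>. In this form minimality can be
  applied without mentioning cosets.\<close>

lemma chief_factor_iff:
  "chief_factor K L C D \<longleftrightarrow> lie_ideal K L C \<and> lie_ideal K L D \<and> D \<subset> C \<and>
    (\<forall>J. lie_ideal K L J \<and> D \<subseteq> J \<and> J \<subseteq> C \<longrightarrow> J = D \<or> J = C)"
proof (cases "lie_ideal K L C \<and> lie_ideal K L D \<and> D \<subset> C")
  case True
  then have C: "lie_ideal K L C" and D: "lie_ideal K L D" and DC: "D \<subset> C" by auto
  have Cc: "C \<subseteq> carrier L" using C by (simp add: lie_ideal_iff)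
  let ?q = "\<lambda>x. D +> x" and ?Q = "lie_quotient L D"
  interpret Q: lie_algebra K ?Q by (rule lie_quotient_lie_algebra[OF lie_algebra_axioms D])
  \<comment> \<open>With the zero ideal written as the image of \<open>D\<close>, both alternatives
    in the definition of a minimal ideal are images of ideals containing \<open>D\<close>.\<close>
  have zero: "{\<zero>\<^bsub>?Q\<^esub>} = ?q ` D"
  proof -
    have z: "\<zero> \<in> D" using D by (simp add: lie_ideal_iff)
    have "D +> x = D +> \<zero>" if x: "x \<in> D" for x
    proof -
      have "x \<in> carrier L" using x D by (auto simp: lie_ideal_iff)
      moreover have "x \<ominus> \<zero> \<in> D" by (rule lie_ideal_minus[OF D x z])
      ultimately show ?thesis using coset_eq_iff[OF D] by blast
    qed
    then have "?q ` D = (\<lambda>_. D +> \<zero>) ` D" by (rule image_cong[OF refl])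
    then have "?q ` D = {D +> \<zero>}" using z by (simp add: image_constant)
    then show ?thesis by (simp add: lie_quotient_zero[OF lie_algebra_axioms D])
  qed
  have carr: "carrier (lie_quotient (L\<lparr>carrier := C\<rparr>) D) = ?q ` C"
    using C D DC by (intro restricted_quotient_carrier lie_ideal_imp_subalgebra) auto
  have inj: "?q ` I = ?q ` J \<longleftrightarrow> I = J"
    if "lie_ideal K L I" "lie_ideal K L J" "D \<subseteq> I" "D \<subseteq> J" for I J
  proof
    assume eq: "?q ` I = ?q ` J"
    have "x \<in> I \<longleftrightarrow> x \<in> J" if "x \<in> carrier L" for x
      using coset_mem_image_iff[OF D, of I x] coset_mem_image_iff[OF D, of J x] that eq
        \<open>lie_ideal K L I\<close> \<open>lie_ideal K L J\<close> \<open>D \<subseteq> I\<close> \<open>D \<subseteq> J\<close> by simp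
    moreover have "I \<subseteq> carrier L" "J \<subseteq> carrier L" using that by (simp_all add: lie_ideal_iff)
    ultimately show "I = J" by blast
  qed simp
  \<comment> \<open>The witness is the full preimage of \<open>X\<close>. It contains
    \<open>D\<close> because \<open>X\<close> contains zero, and it stays inside \<open>C\<close>
    because \<open>C\<close> is a union of cosets of \<open>D\<close>.\<close>
  have surj: "\<exists>J. lie_ideal K L J \<and> D \<subseteq> J \<and> J \<subseteq> C \<and> X = ?q ` J"
    if X: "lie_ideal K ?Q X" "X \<subseteq> ?q ` C" for X
  proof (intro exI conjI)
    let ?J = "{x \<in> carrier L. D +> x \<in> X}"
    show "lie_ideal K L ?J" by (rule ideal_preimage[OF D X(1)])
    have "\<zero>\<^bsub>?Q\<^esub> \<in> X" using X(1) unfolding Q.lie_ideal_iff by blast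
    then have "?q ` D \<subseteq> X" unfolding zero[symmetric] by blast
    moreover have "D \<subseteq> carrier L" using D unfolding lie_ideal_iff by blast
    ultimately show "D \<subseteq> ?J" by blast
    show "?J \<subseteq> C"
      using X(2) coset_mem_image_iff[OF D C] DC by blast
    show "X = ?q ` ?J" using X(2) Cc by blast
  qed
  have "minimal_ideal K ?Q (?q ` C) \<longleftrightarrow>
      (\<forall>J. lie_ideal K L J \<and> D \<subseteq> J \<and> J \<subseteq> C \<longrightarrow> J = D \<or> J = C)"
  proof
    assume min: "minimal_ideal K ?Q (?q ` C)"
    show "\<forall>J. lie_ideal K L J \<and> D \<subseteq> J \<and> J \<subseteq> C \<longrightarrow> J = D \<or> J = C"
    proof (intro allI impI)
      fix J assume J: "lie_ideal K L J \<and> D \<subseteq> J \<and> J \<subseteq> C"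
      then have "lie_ideal K ?Q (?q ` J)" "?q ` J \<subseteq> ?q ` C"
        using ideal_image[OF D] by auto
      then have "?q ` J = ?q ` D \<or> ?q ` J = ?q ` C"
        using min unfolding minimal_ideal_def zero by blast
      then show "J = D \<or> J = C" using inj[of J D] inj[of J C] J C D DC by blast
    qed
  next
    assume lat: "\<forall>J. lie_ideal K L J \<and> D \<subseteq> J \<and> J \<subseteq> C \<longrightarrow> J = D \<or> J = C"
    show "minimal_ideal K ?Q (?q ` C)"
      unfolding minimal_ideal_def zero
    proof (intro conjI allI impI)
      show "lie_ideal K ?Q (?q ` C)" by (rule ideal_image[OF D C])
      show "?q ` C \<noteq> ?q ` D" using inj[OF C D] DC by blast
      fix X assume "lie_ideal K ?Q X \<and> X \<subseteq> ?q ` C"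
      then obtain J where J: "lie_ideal K L J \<and> D \<subseteq> J \<and> J \<subseteq> C" "X = ?q ` J"
        using surj[of X] by auto
      from lat J(1) have "J = D \<or> J = C" by blast
      then show "X = ?q ` D \<or> X = ?q ` C" unfolding J(2) by (elim disjE) simp_all
    qed
  qed
  then show ?thesis using True by (simp add: chief_factor_def carr)
qed (auto simp: chief_factor_def)

section \<open>Existence of c-sections\<close>

lemma ideal_rank_strict_mono:
  assumes "fin_dim" "lie_ideal K L I" "lie_ideal K L J" "I \<subset> J"
  shows "rank I < rank J"
  using assms(2,3)
  by (intro rank_strict_mono[OF assms(1) _ _ assms(4)])
    (simp_all add: lie_ideal_def subspace_def submodule_def)

text \<open>An ideal of least rank with property \<open>Q\<close> works: a proper ideal inside it
  would have smaller rank.\<close>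

lemma ex_minimal_ideal:
  assumes fd: "fin_dim" and ex: "lie_ideal K L I" "Q I"
  shows "\<exists>C. lie_ideal K L C \<and> Q C \<and>
    (\<forall>J. lie_ideal K L J \<longrightarrow> Q J \<longrightarrow> J \<subseteq> C \<longrightarrow> J = C)"
proof -
  obtain C where C: "lie_ideal K L C \<and> Q C"
    and least: "\<And>J. lie_ideal K L J \<and> Q J \<Longrightarrow> rank C \<le> rank J"
    using ex_has_least_nat[of "\<lambda>J. lie_ideal K L J \<and> Q J" I rank] ex by blast
  have "J = C" if "lie_ideal K L J" "Q J" "J \<subseteq> C" for J
  proof (rule ccontr)
    assume "J \<noteq> C"
    then have "rank J < rank C"
      using that C by (intro ideal_rank_strict_mono[OF fd]) auto
    then show False using least[of J] that by simp
  qed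
  then show ?thesis using C by blast
qed

text \<open>Ranks are bounded by the dimension of \<open>L\<close>, so the greatest rank among the
  ideals with property \<open>Q\<close> is attained, and an ideal attaining it cannot be
  enlarged.\<close>

lemma ex_maximal_ideal:
  assumes fd: "fin_dim" and ex: "lie_ideal K L I" "Q I"
  shows "\<exists>D. lie_ideal K L D \<and> Q D \<and>
    (\<forall>J. lie_ideal K L J \<longrightarrow> Q J \<longrightarrow> D \<subseteq> J \<longrightarrow> J = D)"
proof -
  have bound: "rank J < Suc dim" if "lie_ideal K L J \<and> Q J" for J
    using that rank_le_dim[OF fd] by (simp add: lie_ideal_iff le_imp_less_Suc)
  obtain D where D: "lie_ideal K L D \<and> Q D"
    and greatest: "\<And>J. lie_ideal K L J \<and> Q J \<Longrightarrow> rank J \<le> rank D"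
    using ex_has_greatest_nat[of "\<lambda>J. lie_ideal K L J \<and> Q J" I rank "Suc dim"] ex bound
    by (auto intro: less_imp_le)
  have "J = D" if "lie_ideal K L J" "Q J" "D \<subseteq> J" for J
  proof (rule ccontr)
    assume "J \<noteq> D"
    then have "rank D < rank J"
      using that D by (intro ideal_rank_strict_mono[OF fd]) auto
    then show False using greatest[of J] that by simp
  qed
  then show ?thesis using D by blast
qed

lemma c_section_exists:
  assumes fd: "fin_dim" and M: "maximal_subalgebra K L M"
  shows "\<exists>S. c_section K L M S"
proof -
  have Ms: "lie_subalgebra K L M" and Mc: "M \<subseteq> carrier L"
    using M by (auto simp: maximal_subalgebra_def lie_subalgebra_iff)
  \<comment> \<open>\<open>L\<close> itself is an ideal not contained in \<open>M\<close>, so there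
    is a minimal ideal of this kind.\<close>
  have "\<not> carrier L \<subseteq> M" using M Mc by (auto simp: maximal_subalgebra_def)
  then obtain C where C: "lie_ideal K L C" "\<not> C \<subseteq> M"
    and Cmin: "\<And>J. \<lbrakk>lie_ideal K L J; \<not> J \<subseteq> M; J \<subseteq> C\<rbrakk> \<Longrightarrow> J = C"
    using ex_minimal_ideal[OF fd carrier_ideal, of "\<lambda>J. \<not> J \<subseteq> M"] by blast
  have Cc: "C \<subseteq> carrier L" using C by (simp add: lie_ideal_iff)
  have "{\<zero>} \<subseteq> M \<inter> C" using Ms C by (simp add: lie_subalgebra_iff lie_ideal_iff)
  then obtain D where D: "lie_ideal K L D" "D \<subseteq> M \<inter> C"
    and Dmax: "\<And>J. \<lbrakk>lie_ideal K L J; J \<subseteq> M \<inter> C; D \<subseteq> J\<rbrakk> \<Longrightarrow> J = D"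
    using ex_maximal_ideal[OF fd zero_ideal, of "\<lambda>J. J \<subseteq> M \<inter> C"] by blast
  \<comment> \<open>If \<open>J\<close> lies in \<open>M\<close>, maximality of \<open>D\<close>
    gives \<open>J = D\<close>; otherwise minimality of \<open>C\<close> gives
    \<open>J = C\<close>.\<close>
  have "J = D \<or> J = C" if "lie_ideal K L J" "D \<subseteq> J" "J \<subseteq> C" for J
    using Cmin[OF that(1) _ that(3)] Dmax[OF that(1) _ that(2)] that(3) by blast
  then have "chief_factor K L C D"
    using C D unfolding chief_factor_iff by blast
  \<comment> \<open>The sum is a subalgebra containing \<open>M\<close>, strictly because
    \<open>C\<close> is not inside \<open>M\<close>, so maximality of \<open>M\<close>
    applies.\<close>
  moreover have "carrier L = M <+>\<^bsub>L\<^esub> C"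
  proof -
    have "M \<subseteq> M <+>\<^bsub>L\<^esub> C" "C \<subseteq> M <+>\<^bsub>L\<^esub> C"
      using Ms C Mc Cc
      by (simp_all add: lie_subalgebra_iff lie_ideal_iff subset_set_add_left
          subset_set_add_right)
    moreover have "lie_subalgebra K L (M <+>\<^bsub>L\<^esub> C)" by (rule subalgebra_add_ideal[OF Ms C(1)])
    ultimately show ?thesis using M C(2) unfolding maximal_subalgebra_def by blast
  qed
  ultimately show ?thesis unfolding c_section_def using D(2) by blast
qed

section \<open>Uniqueness of c-sections\<close>

text \<open>Splitting an element of \<open>L\<close> as a sum from \<open>M\<close> and
  \<open>E\<close> shows that \<open>M \<inter> C\<close> absorbs brackets: the \<open>M\<close>
  part preserves \<open>M\<close>, and \<open>br\<close> handles the \<open>E\<close> part. This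
  ideal lies between \<open>D\<close> and \<open>C\<close>, and it is not \<open>C\<close>, since
  \<open>C \<subseteq> M\<close> would give \<open>M + C = M\<close>.\<close>

lemma chief_factor_Int_eq:
  assumes cf: "chief_factor K L C D" and M: "lie_subalgebra K L M" and "D \<subseteq> M"
    and MC: "carrier L = M <+>\<^bsub>L\<^esub> C" and E: "lie_ideal K L E" and ME: "carrier L = M <+>\<^bsub>L\<^esub> E"
    and br: "\<And>c e. \<lbrakk>c \<in> C; e \<in> E\<rbrakk> \<Longrightarrow> bracket L e c \<in> M"
    and proper: "M \<noteq> carrier L"
  shows "M \<inter> C = D"
proof -
  have C: "lie_ideal K L C" and DC: "D \<subseteq> C"
    using cf by (auto simp: chief_factor_iff)
  have sub: "M \<subseteq> carrier L" "C \<subseteq> carrier L" "E \<subseteq> carrier L"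
    using M C E by (auto simp: lie_subalgebra_iff lie_ideal_iff)
  have "bracket L x m \<in> M \<inter> C" if x: "x \<in> carrier L" and m: "m \<in> M \<inter> C" for x m
  proof
    obtain y e where y: "y \<in> M" "e \<in> E" "x = y \<oplus> e" using x ME by (auto simp: mem_set_add)
    then have "bracket L x m = bracket L y m \<oplus> bracket L e m"
      using m sub by (auto simp: bracket_add_left subset_iff)
    then show "bracket L x m \<in> M"
      using y m br M by (simp add: lie_subalgebra_iff)
    show "bracket L x m \<in> C" using x m C by (simp add: lie_ideal_iff)
  qed
  then have "lie_ideal K L (M \<inter> C)"
    using M C by (auto simp: lie_ideal_iff lie_subalgebra_iff)
  moreover have "M \<inter> C \<noteq> C"
    using set_add_subset[OF M, of M C] MC proper sub by blast
  ultimately show ?thesis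
    using cf \<open>D \<subseteq> M\<close> DC unfolding chief_factor_iff by blast
qed

text \<open>\<open>G + D\<close> lies between \<open>D\<close> and \<open>C\<close> and is not
  inside \<open>M\<close>, so it equals \<open>C\<close>. Intersecting with \<open>M\<close>, which
  contains \<open>D\<close>, is then the modular law.\<close>

lemma chief_factor_supplement:
  assumes cf: "chief_factor K L C D" and M: "lie_subalgebra K L M" and "D \<subseteq> M"
    and G: "lie_ideal K L G" "G \<subseteq> C" "\<not> G \<subseteq> M"
  shows "M \<inter> C = (M \<inter> G) <+>\<^bsub>L\<^esub> D"
proof -
  have C: "lie_ideal K L C" and D: "lie_ideal K L D" and DC: "D \<subseteq> C"
    using cf by (auto simp: chief_factor_iff)
  have sub: "G \<subseteq> carrier L" "D \<subseteq> carrier L" and zero: "\<zero> \<in> G" "\<zero> \<in> D"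
    using G D by (auto simp: lie_ideal_iff)
  have "lie_ideal K L (G <+>\<^bsub>L\<^esub> D)" by (rule ideal_add_ideal[OF G(1) D])
  moreover have "G <+>\<^bsub>L\<^esub> D \<subseteq> C"
    by (rule set_add_subset[OF lie_ideal_imp_subalgebra[OF C] G(2) DC])
  moreover have "G \<subseteq> G <+>\<^bsub>L\<^esub> D" "D \<subseteq> G <+>\<^bsub>L\<^esub> D"
    using sub zero by (simp_all add: subset_set_add_left subset_set_add_right)
  ultimately have GD: "G <+>\<^bsub>L\<^esub> D = C"
    using cf \<open>D \<subseteq> M\<close> G(3) unfolding chief_factor_iff by blast
  show ?thesis
  proof
    have "(M \<inter> G) <+>\<^bsub>L\<^esub> D \<subseteq> M"
      by (rule set_add_subset[OF M]) (use \<open>D \<subseteq> M\<close> in auto)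
    moreover have "(M \<inter> G) <+>\<^bsub>L\<^esub> D \<subseteq> C"
      by (rule set_add_subset[OF lie_ideal_imp_subalgebra[OF C]]) (use G(2) DC in auto)
    ultimately show "(M \<inter> G) <+>\<^bsub>L\<^esub> D \<subseteq> M \<inter> C" by blast
    show "M \<inter> C \<subseteq> (M \<inter> G) <+>\<^bsub>L\<^esub> D"
    proof
      fix x assume x: "x \<in> M \<inter> C"
      then obtain g d where g: "g \<in> G" "d \<in> D" "x = g \<oplus> d" using GD by (auto simp: mem_set_add)
      have "x \<ominus> d \<in> M" using x g \<open>D \<subseteq> M\<close> by (intro lie_subalgebra_minus[OF M]) auto
      moreover have "x \<ominus> d = g" using g sub by (simp add: add_minus_cancel subset_iff)
      ultimately show "x \<in> (M \<inter> G) <+>\<^bsub>L\<^esub> D" using g by (simp add: set_addI)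
    qed
  qed
qed

text \<open>\<open>(E \<inter> D) + F\<close> is an ideal between \<open>F\<close> and
  \<open>E\<close>. It lies in \<open>M\<close> while \<open>E\<close> does not, so it must be
  \<open>F\<close>.\<close>

lemma chief_factor_Int_subset:
  assumes cf: "chief_factor K L E F" and M: "lie_subalgebra K L M" and "F \<subseteq> M"
    and ME: "\<not> E \<subseteq> M" and D: "lie_ideal K L D" "D \<subseteq> M"
  shows "E \<inter> D \<subseteq> F"
proof -
  have E: "lie_ideal K L E" and F: "lie_ideal K L F" and FE: "F \<subseteq> E"
    using cf by (auto simp: chief_factor_iff)
  let ?I = "(E \<inter> D) <+>\<^bsub>L\<^esub> F"
  have ED: "lie_ideal K L (E \<inter> D)" by (rule ideal_Int[OF E D(1)])
  have "lie_ideal K L ?I" by (rule ideal_add_ideal[OF ED F])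
  moreover have "?I \<subseteq> E"
    by (rule set_add_subset[OF lie_ideal_imp_subalgebra[OF E]]) (use FE in auto)
  moreover have "?I \<subseteq> M" by (rule set_add_subset[OF M]) (use D \<open>F \<subseteq> M\<close> in auto)
  moreover have "E \<inter> D \<subseteq> ?I" "F \<subseteq> ?I"
    using ED F subset_set_add_left[of "E \<inter> D" F] subset_set_add_right[of "E \<inter> D" F]
    unfolding lie_ideal_iff by blast+
  ultimately show ?thesis using cf ME unfolding chief_factor_iff by blast
qed

lemma c_section_unique:
  assumes max: "maximal_subalgebra K L M"
    and S: "c_section K L M S" and T: "c_section K L M T"
  shows "lie_isomorphic K S T"
proof -
  have M: "lie_subalgebra K L M" and proper: "M \<noteq> carrier L"
    using max by (auto simp: maximal_subalgebra_def)
  obtain C D where CD: "chief_factor K L C D" and DM: "D \<subseteq> M" and MC: "carrier L = M <+>\<^bsub>L\<^esub> C"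
    and S: "S = lie_quotient (L\<lparr>carrier := M \<inter> C\<rparr>) D"
    using S by (auto simp: c_section_def)
  obtain E F where EF: "chief_factor K L E F" and FM: "F \<subseteq> M" and ME: "carrier L = M <+>\<^bsub>L\<^esub> E"
    and T: "T = lie_quotient (L\<lparr>carrier := M \<inter> E\<rparr>) F"
    using T by (auto simp: c_section_def)
  have C: "lie_ideal K L C" and D: "lie_ideal K L D" and E: "lie_ideal K L E"
    and F: "lie_ideal K L F"
    using CD EF unfolding chief_factor_def by blast+
  have sub: "C \<subseteq> carrier L" "E \<subseteq> carrier L" "D \<subseteq> carrier L" "F \<subseteq> carrier L"
    using C D E F by (auto simp: lie_ideal_iff)
  \<comment> \<open>\<open>P\<close> is a common source of representatives for both c-sections: they
    become \<open>(P + D)/D\<close> and \<open>(P + F)/F\<close> with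
    \<open>P \<inter> D = P \<inter> F\<close>.\<close>
  obtain P where P: "lie_subalgebra K L P" "M \<inter> C = P <+>\<^bsub>L\<^esub> D" "M \<inter> E = P <+>\<^bsub>L\<^esub> F" "P \<inter> D = P \<inter> F"
  proof (cases "C \<inter> E \<subseteq> M")
    case True
    \<comment> \<open>The bracket of elements of two ideals lies in their intersection.\<close>
    have br: "bracket L x y \<in> M"
      if I: "lie_ideal K L I" "lie_ideal K L J" "I \<inter> J \<subseteq> M" and x: "x \<in> I" and y: "y \<in> J" for I J x y
    proof -
      have "x \<in> carrier L" "y \<in> carrier L" using I x y by (auto simp: lie_ideal_iff)
      then have "bracket L x y \<in> I" "bracket L x y \<in> J"
        using lie_ideal_bracket_left[OF I(1) x] I(2) y by (simp_all add: lie_ideal_iff)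
      then show ?thesis using I(3) by blast
    qed
    have sum0: "{\<zero>} <+>\<^bsub>L\<^esub> I = I" if "I \<subseteq> carrier L" for I
      using that by (auto simp: set_add_def' subset_iff)
    have "M \<inter> C = D"
      by (rule chief_factor_Int_eq[OF CD M DM MC E ME _ proper]) (use True in \<open>auto intro: br[OF E C]\<close>)
    moreover have "M \<inter> E = F"
      by (rule chief_factor_Int_eq[OF EF M FM ME C MC _ proper]) (use True in \<open>auto intro: br[OF C E]\<close>)
    moreover have "{\<zero>} \<inter> D = {\<zero>} \<inter> F" using D F by (simp add: lie_ideal_iff)
    \<comment> \<open>Both c-sections are zero here, so the zero subalgebra serves as
      \<open>P\<close>.\<close>
    ultimately show thesis
      using lie_ideal_imp_subalgebra[OF zero_ideal] sum0 sub(3,4)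
      by (intro that[of "{\<zero>}"]) simp_all
  next
    case False
    have G: "lie_ideal K L (C \<inter> E)" by (rule ideal_Int[OF C E])
    \<comment> \<open>As \<open>C \<inter> E\<close> is not inside \<open>M\<close>, neither
      \<open>C\<close> nor \<open>E\<close> is. The two inclusions make \<open>D\<close> and
      \<open>F\<close> agree on \<open>C \<inter> E\<close>.\<close>
    have "E \<inter> D \<subseteq> F"
      by (rule chief_factor_Int_subset[OF EF M FM _ D DM]) (use False in blast)
    moreover have "C \<inter> F \<subseteq> D"
      by (rule chief_factor_Int_subset[OF CD M DM _ F FM]) (use False in blast)
    ultimately have "(M \<inter> (C \<inter> E)) \<inter> D = (M \<inter> (C \<inter> E)) \<inter> F" by blast
    moreover have "M \<inter> C = (M \<inter> (C \<inter> E)) <+>\<^bsub>L\<^esub> D"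
      by (rule chief_factor_supplement[OF CD M DM G Int_lower1 False])
    moreover have "M \<inter> E = (M \<inter> (C \<inter> E)) <+>\<^bsub>L\<^esub> F"
      by (rule chief_factor_supplement[OF EF M FM G Int_lower2 False])
    moreover have "lie_subalgebra K L (M \<inter> (C \<inter> E))"
      by (intro subalgebra_Int M lie_ideal_imp_subalgebra G)
    ultimately show thesis by (intro that[of "M \<inter> (C \<inter> E)"])
  qed
  show ?thesis
    unfolding S T P(2,3) by (rule lie_isomorphic_add_quotient[OF P(1) D F P(4)])
qed

end

theorem lemma1p1:
  fixes K :: "('k, 'r) ring_scheme"
    and L :: "('k, 'a, 'm) lie_struct_scheme"
    and M :: "'a set"
  assumes "lie_algebra K L"
    and "vectorspace.fin_dim K L"
    and "maximal_subalgebra K L M"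
  shows "(\<exists>S. c_section K L M S) \<and>
    (\<forall>S T. c_section K L M S \<and> c_section K L M T \<longrightarrow> lie_isomorphic K S T)"
  using lie_algebra.c_section_exists[OF assms] lie_algebra.c_section_unique[OF assms(1,3)] by blast

end
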